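(* Let $f$ be a $2\pi$-periodic, continuous, complex-valued function which has no zeros in $(-\pi,\pi]$. Then the eigenvalues of $\mathcal{C}_n^{-1}(f)T_n(f)$ are clustered, in the sense of proper clustering, around the point $(1,0)$ of the complex plane.
   Context: $T_n(f)$ is the $n\times n$ Toeplitz matrix with $(j,k)$ entry $\frac{1}{2\pi}\int_{-\pi}^{\pi}f(x)\mathrm{e}^{-\mathrm{i}(j-k)x}\,\mathrm{d}x$. $\mathcal{C}_n(f)=\mathcal{F}_n^H\Lambda_n(f)\mathcal{F}_n$ is the circulant matrix with eigenvalues $f\left(\frac{2\pi(k-1)}{n}\right)$, $k=1,\dots,n$, where $\Lambda_n(f)$ is the diagonal matrix of these values (in this order) and $\mathcal{F}_n=\frac{1}{\sqrt n}\left(\omega^{(j-1)(k-1)}\right)_{j,k=1}^n$, $\omega=\mathrm{e}^{2\pi\mathrm{i}/n}$; $\mathcal{C}_n^{-1}(f)=(\mathcal{C}_n(f))^{-1}$. The point $(1,0)$ is the complex number $1$. The eigenvalues of $\{A_n\}$, $A_n\in\mathbb{C}^{n\times n}$, are properly clustered around $z_0\in\mathbb{C}$ if for every $\varepsilon>0$ the number of eigenvalues $\lambda$ of $A_n$ with $|\lambda-z_0|\geq\varepsilon$ is bounded by a constant $c(\varepsilon)$ independent of $n$. *)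

theory Defs
  imports "HOL-Analysis.Analysis" "Jordan_Normal_Form.Spectral_Radius"
begin

(* Matrices are those of Jordan_Normal_Form, hence 0-based: the entry with indices j, k in
   {1..n} on paper is the one with indices j - 1, k - 1 here. *)

definition fourier_coefficient :: "(real \<Rightarrow> complex) \<Rightarrow> int \<Rightarrow> complex" where
  "fourier_coefficient f m =
     1 / (2 * complex_of_real pi) *
     integral {-pi..pi} (\<lambda>x. f x * exp (- (\<i> * of_int m * complex_of_real x)))"

definition toeplitz :: "nat \<Rightarrow> (real \<Rightarrow> complex) \<Rightarrow> complex mat" where
  "toeplitz n f = Matrix.mat n n (\<lambda>(j, k). fourier_coefficient f (int j - int k))"

definition fourier_matrix :: "nat \<Rightarrow> complex mat" where
  "fourier_matrix n =
     complex_of_real (1 / sqrt (real n)) \<cdot>\<^sub>m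
     Matrix.mat n n (\<lambda>(j, k). exp (2 * complex_of_real pi * \<i> / of_nat n) ^ (j * k))"

definition circulant :: "nat \<Rightarrow> (real \<Rightarrow> complex) \<Rightarrow> complex mat" where
  "circulant n f =
     mat_adjoint (fourier_matrix n)
     * mat_diag n (\<lambda>k. f (2 * pi * real k / real n))
     * fourier_matrix n"

(* Eigenvalues are counted with algebraic multiplicity. The carrier condition records that
   A n is an n x n matrix, so that the spectrum summed over is finite. *)
definition properly_clustered :: "(nat \<Rightarrow> complex mat) \<Rightarrow> complex \<Rightarrow> bool" where
  "properly_clustered A z0 \<longleftrightarrow>
     (\<forall>n\<ge>1. A n \<in> carrier_mat n n) \<and>
     (\<forall>\<epsilon>>0. \<exists>c :: nat. \<forall>n\<ge>1.
        (\<Sum>z\<in>{z \<in> spectrum (A n). cmod (z - z0) \<ge> \<epsilon>}. order z (char_poly (A n))) \<le> c)"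

end

theory Submission
  imports Defs "HOL-Complex_Analysis.Conformal_Mappings"
begin

text \<open>
  Write \<open>T\<close> and \<open>C\<close> for the Toeplitz and circulant matrices of size \<open>n\<close>. Approximate \<open>f\<close> uniformly
  within \<open>\<delta>\<close> by a trigonometric polynomial \<open>p\<close> (\<open>trig_poly_dense\<close>). Since the inverse of \<open>C f\<close> is
  \<open>C (1 / f)\<close>,
  \<open>C (1 / f) * T f = 1 + C (1 / f) * (T - C) (f - p) + C (1 / f) * (T - C) p\<close>.
  The matrices \<open>T g\<close> and \<open>C g\<close> have norm at most \<open>sup |g|\<close> (\<open>avg_matrix_op_bounded\<close>), so the first
  perturbation has norm at most \<open>2 \<delta> / min |f|\<close>. The second one is bounded, and it vanishes outside a
  number of columns that depends on \<open>p\<close> but not on \<open>n\<close> (\<open>trig_poly_toeplitz_eq_circulant\<close>).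

  It remains to count the eigenvalues of \<open>1 + E + R\<close> at distance at least \<open>\<epsilon>\<close> from \<open>1\<close> when \<open>E\<close> is
  small and \<open>R\<close> is bounded with few nonzero columns (\<open>eigenvalues_off_1_bound\<close>). These matrices are
  in general not normal, so interlacing is not available. Instead,
  \<open>det (z - E - R) / det (z - E) = det (1 - S * R)\<close> with \<open>S\<close> the inverse of \<open>z - E\<close>. This is a
  holomorphic function outside a small disk, it tends to \<open>1\<close> at infinity, and it is bounded on a
  circle \<open>|z| = q\<close> with \<open>q < \<epsilon>\<close> independently of \<open>n\<close>, as only few columns of \<open>1 - S * R\<close> differ
  from those of the identity (\<open>det_bound_few_columns\<close>). Hence the number of its zeros with
  \<open>|z| \<ge> \<epsilon>\<close> is bounded by Jensen's argument (\<open>count_large_roots\<close>).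
\<close>

unbundle no vec_syntax
no_notation fps_nth (infixl "$" 75)

section \<open>Euclidean operator bounds for square matrices\<close>

definition vnorm :: "complex Matrix.vec \<Rightarrow> real" where
  "vnorm v = L2_set (\<lambda>i. cmod (v $ i)) {..<dim_vec v}"

lemma vnorm_triangle:
  assumes "u \<in> carrier_vec n" "v \<in> carrier_vec n"
  shows "vnorm (u + v) \<le> vnorm u + vnorm v"
proof -
  have "vnorm (u + v) = L2_set (\<lambda>i. cmod (u $ i + v $ i)) {..<n}"
    unfolding vnorm_def using assms by (intro L2_set_cong) auto
  also have "\<dots> \<le> L2_set (\<lambda>i. cmod (u $ i) + cmod (v $ i)) {..<n}"
    by (intro L2_set_mono norm_triangle_ineq) auto
  also have "\<dots> \<le> vnorm u + vnorm v"
    using L2_set_triangle_ineq[of "\<lambda>i. cmod (u $ i)" "\<lambda>i. cmod (v $ i)" "{..<n}"] assms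
    by (auto simp: vnorm_def)
  finally show ?thesis .
qed

lemma vnorm_smult: "vnorm (c \<cdot>\<^sub>v v) = cmod c * vnorm v"
proof -
  have "vnorm (c \<cdot>\<^sub>v v) = L2_set (\<lambda>i. cmod c * cmod (v $ i)) {..<dim_vec v}"
    unfolding vnorm_def by (intro L2_set_cong) (auto simp: norm_mult)
  also have "\<dots> = cmod c * vnorm v"
    unfolding vnorm_def by (rule L2_set_right_distrib[symmetric]) simp
  finally show ?thesis .
qed

lemma component_le_vnorm: "i < dim_vec v \<Longrightarrow> cmod (v $ i) \<le> vnorm v"
  unfolding vnorm_def by (rule member_le_L2_set) auto

lemma vnorm_unit_vec:
  assumes "k < n"
  shows "vnorm (unit_vec n k) = 1"
proof -
  have "(\<Sum>i<n. (cmod (unit_vec n k $ i))\<^sup>2) = (\<Sum>i<n. if i = k then 1 else 0)"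
    using assms by (intro sum.cong) auto
  then show ?thesis using assms by (simp add: vnorm_def L2_set_def)
qed

lemma vnorm_eq_0_imp:
  assumes "v \<in> carrier_vec n" "vnorm v \<le> 0"
  shows "v = 0\<^sub>v n"
proof (rule eq_vecI)
  fix i assume "i < dim_vec (0\<^sub>v n :: complex Matrix.vec)"
  then have "i < n" by simp
  moreover have "cmod (v $ i) \<le> 0"
    using component_le_vnorm[of i v] assms \<open>i < n\<close> by (intro order_trans[OF _ assms(2)]) auto
  ultimately show "v $ i = 0\<^sub>v n $ i" by simp
qed (use assms in auto)

definition op_bounded :: "nat \<Rightarrow> real \<Rightarrow> complex mat \<Rightarrow> bool" where
  "op_bounded n c A \<longleftrightarrow>
     A \<in> carrier_mat n n \<and> (\<forall>v\<in>carrier_vec n. vnorm (A *\<^sub>v v) \<le> c * vnorm v)"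

lemma op_boundedD:
  assumes "op_bounded n c A"
  shows "A \<in> carrier_mat n n" "v \<in> carrier_vec n \<Longrightarrow> vnorm (A *\<^sub>v v) \<le> c * vnorm v"
  using assms unfolding op_bounded_def by auto

lemma op_bounded_add:
  assumes "op_bounded n a A" "op_bounded n b B"
  shows "op_bounded n (a + b) (A + B)"
  unfolding op_bounded_def
proof (intro conjI ballI)
  note c = op_boundedD(1)[OF assms(1)] op_boundedD(1)[OF assms(2)]
  show "A + B \<in> carrier_mat n n" using c by simp
  fix v :: "complex Matrix.vec" assume v: "v \<in> carrier_vec n"
  have "vnorm ((A + B) *\<^sub>v v) = vnorm (A *\<^sub>v v + B *\<^sub>v v)"
    using c v by (simp add: add_mult_distrib_mat_vec)
  also have "\<dots> \<le> vnorm (A *\<^sub>v v) + vnorm (B *\<^sub>v v)"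
    using c v by (intro vnorm_triangle[of _ n]) auto
  also have "\<dots> \<le> a * vnorm v + b * vnorm v"
    using op_boundedD(2)[OF assms(1) v] op_boundedD(2)[OF assms(2) v] by simp
  finally show "vnorm ((A + B) *\<^sub>v v) \<le> (a + b) * vnorm v" by (simp add: algebra_simps)
qed

lemma op_bounded_uminus:
  assumes "op_bounded n a A"
  shows "op_bounded n a (- A)"
  unfolding op_bounded_def
proof (intro conjI ballI)
  note c = op_boundedD(1)[OF assms(1)]
  show "- A \<in> carrier_mat n n" using c by simp
  fix v :: "complex Matrix.vec" assume v: "v \<in> carrier_vec n"
  have "(- A) *\<^sub>v v = (-1) \<cdot>\<^sub>v (A *\<^sub>v v)"
    using c v by (intro eq_vecI) (auto simp: scalar_prod_def sum_negf)
  then show "vnorm (- A *\<^sub>v v) \<le> a * vnorm v"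
    using op_boundedD(2)[OF assms v] by (simp add: vnorm_smult)
qed

lemma op_bounded_minus:
  assumes "op_bounded n a A" "op_bounded n b B"
  shows "op_bounded n (a + b) (A - B)"
proof -
  have "A - B = A + (- B)"
    using op_boundedD(1)[OF assms(1)] op_boundedD(1)[OF assms(2)] by (intro eq_matI) auto
  then show ?thesis using op_bounded_add[OF assms(1) op_bounded_uminus[OF assms(2)]] by simp
qed

lemma op_bounded_mult:
  assumes "op_bounded n a A" "op_bounded n b B" "0 \<le> a"
  shows "op_bounded n (a * b) (A * B)"
  unfolding op_bounded_def
proof (intro conjI ballI)
  note c = op_boundedD(1)[OF assms(1)] op_boundedD(1)[OF assms(2)]
  show "A * B \<in> carrier_mat n n" using c by simp
  fix v :: "complex Matrix.vec" assume v: "v \<in> carrier_vec n"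
  have "vnorm ((A * B) *\<^sub>v v) = vnorm (A *\<^sub>v (B *\<^sub>v v))"
    using c v by (simp add: assoc_mult_mat_vec[OF c v])
  also have "\<dots> \<le> a * vnorm (B *\<^sub>v v)"
    using c v by (intro op_boundedD(2)[OF assms(1)]) auto
  also have "\<dots> \<le> a * (b * vnorm v)"
    using op_boundedD(2)[OF assms(2) v] assms(3) by (intro mult_left_mono) auto
  finally show "vnorm ((A * B) *\<^sub>v v) \<le> a * b * vnorm v" by (simp add: mult.assoc)
qed

lemma op_bounded_entry:
  assumes "op_bounded n c A" "i < n" "j < n"
  shows "cmod (A $$ (i, j)) \<le> c"
proof -
  note A = op_boundedD(1)[OF assms(1)]
  have "A $$ (i, j) = (A *\<^sub>v unit_vec n j) $ i"
    using A assms(2,3) by simp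
  also have "cmod \<dots> \<le> vnorm (A *\<^sub>v unit_vec n j)"
    using A assms(2) by (intro component_le_vnorm) auto
  also have "\<dots> \<le> c"
    using op_boundedD(2)[OF assms(1), of "unit_vec n j"] vnorm_unit_vec[OF assms(3)] by simp
  finally show ?thesis .
qed

lemma det_nonzero_obtain_inverse:
  fixes M :: "complex mat"
  assumes M: "M \<in> carrier_mat n n" and "Determinant.det M \<noteq> 0"
  obtains S where "S \<in> carrier_mat n n" "S * M = 1\<^sub>m n" "M * S = 1\<^sub>m n"
proof -
  from det_non_zero_imp_unit[OF M assms(2)] show ?thesis
    using that by (auto simp: Units_def ring_mat_def)
qed

text \<open>Both claims rest on
  \<open>\<parallel>(z - E) v\<parallel> \<ge> (|z| - e) \<parallel>v\<parallel>\<close>, which makes \<open>z - E\<close> injective and bounds its inverse.\<close>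

lemma
  assumes E: "op_bounded n e E" and z: "e < cmod z"
  shows det_nonzero_outside_bound: "Determinant.det (z \<cdot>\<^sub>m 1\<^sub>m n - E) \<noteq> 0"
    and resolvent_op_bounded:
      "\<exists>S. op_bounded n (1 / (cmod z - e)) S \<and> (z \<cdot>\<^sub>m 1\<^sub>m n - E) * S = 1\<^sub>m n"
proof -
  define M where "M = z \<cdot>\<^sub>m 1\<^sub>m n - E"
  note Ec = op_boundedD(1)[OF E]
  have M: "M \<in> carrier_mat n n" unfolding M_def using Ec by (simp add: minus_carrier_mat)
  have lower: "(cmod z - e) * vnorm v \<le> vnorm (M *\<^sub>v v)" if v: "v \<in> carrier_vec n" for v
  proof -
    have "z \<cdot>\<^sub>v v = M *\<^sub>v v + E *\<^sub>v v"
      unfolding M_def using Ec v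
      by (subst minus_mult_distrib_mat_vec[of _ n n]) (auto intro!: eq_vecI)
    then have "cmod z * vnorm v = vnorm (M *\<^sub>v v + E *\<^sub>v v)"
      by (metis vnorm_smult)
    also have "\<dots> \<le> vnorm (M *\<^sub>v v) + vnorm (E *\<^sub>v v)"
      using M Ec v by (intro vnorm_triangle[of _ n]) auto
    also have "\<dots> \<le> vnorm (M *\<^sub>v v) + e * vnorm v"
      using op_boundedD(2)[OF E v] by simp
    finally show ?thesis by (simp add: algebra_simps)
  qed
  show det: "Determinant.det (z \<cdot>\<^sub>m 1\<^sub>m n - E) \<noteq> 0"
  proof
    assume "Determinant.det (z \<cdot>\<^sub>m 1\<^sub>m n - E) = 0"
    then obtain v where v: "v \<in> carrier_vec n" "v \<noteq> 0\<^sub>v n" "M *\<^sub>v v = 0\<^sub>v n"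
      using det_0_iff_vec_prod_zero[OF M] unfolding M_def by auto
    have "vnorm (0\<^sub>v n :: complex Matrix.vec) = 0" by (simp add: vnorm_def L2_set_def)
    with lower[OF v(1)] v(3) z have "vnorm v \<le> 0"
      by (simp add: mult_le_0_iff)
    with vnorm_eq_0_imp v show False by blast
  qed
  obtain S where S: "S \<in> carrier_mat n n" "S * M = 1\<^sub>m n" "M * S = 1\<^sub>m n"
    using det_nonzero_obtain_inverse[OF M] det unfolding M_def by blast
  have "op_bounded n (1 / (cmod z - e)) S"
    unfolding op_bounded_def
  proof (intro conjI ballI S(1))
    fix v :: "complex Matrix.vec" assume v: "v \<in> carrier_vec n"
    have "M *\<^sub>v (S *\<^sub>v v) = v"
      using v S M by (simp flip: assoc_mult_mat_vec[OF M S(1) v])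
    with lower[of "S *\<^sub>v v"] v S have "(cmod z - e) * vnorm (S *\<^sub>v v) \<le> vnorm v" by auto
    with z show "vnorm (S *\<^sub>v v) \<le> 1 / (cmod z - e) * vnorm v"
      by (simp add: field_simps)
  qed
  with S(3) show "\<exists>S. op_bounded n (1 / (cmod z - e)) S \<and> (z \<cdot>\<^sub>m 1\<^sub>m n - E) * S = 1\<^sub>m n"
    unfolding M_def by blast
qed

text \<open>In the Leibniz expansion only permutations of \<open>J\<close> survive: an index outside
  \<open>J\<close> must be fixed, because its column is a unit vector. This keeps the bound free of the size
  \<open>n\<close>.\<close>

lemma det_bound_few_columns:
  fixes X :: "complex mat"
  assumes X: "X \<in> carrier_mat n n" and J: "J \<subseteq> {0..<n}"
    and cols: "\<And>i k. i < n \<Longrightarrow> k < n \<Longrightarrow> k \<notin> J \<Longrightarrow> X $$ (i, k) = (if i = k then 1 else 0)"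
    and entries: "\<And>i k. i < n \<Longrightarrow> k < n \<Longrightarrow> cmod (X $$ (i, k)) \<le> c"
  shows "cmod (Determinant.det X) \<le> fact (card J) * c ^ card J"
proof -
  define t where "t p = signof p * (\<Prod>i = 0..<n. X $$ (i, p i))" for p
  have finJ: "finite J" using J finite_subset by blast
  have zero: "t p = 0" if p: "p permutes {0..<n}" "\<not> p permutes J" for p
  proof (rule ccontr)
    assume "t p \<noteq> 0"
    then have nz: "X $$ (i, p i) \<noteq> 0" if "i < n" for i
      using that by (auto simp: t_def)
    have "p permutes J"
      unfolding permutes_def
    proof (intro conjI allI impI)
      fix x assume x: "x \<notin> J"
      show "p x = x"
      proof (cases "x < n")
        case False
        then show ?thesis using p(1) by (auto simp: permutes_def)
      next
        case True
        obtain i where i: "p i = x" using p(1) by (meson permutes_def)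
        have "i < n" using True i permutes_in_image[OF p(1), of i] by auto
        with nz[of i] cols[of i x] x True i show ?thesis by (auto split: if_splits)
      qed
    next
      fix y show "\<exists>!x. p x = y" using p(1) by (simp add: permutes_def)
    qed
    with p(2) show False ..
  qed
  have "Determinant.det X = (\<Sum>p\<in>{p. p permutes {0..<n}}. t p)"
    unfolding t_def by (rule det_def'[OF X])
  also have "\<dots> = (\<Sum>p\<in>{p. p permutes J}. t p)"
    by (rule sum.mono_neutral_right)
      (use zero permutes_subset[OF _ J] in \<open>auto simp: finite_permutations\<close>)
  finally have "cmod (Determinant.det X) \<le> (\<Sum>p\<in>{p. p permutes J}. cmod (t p))"
    by (simp add: norm_sum)
  also have "\<dots> \<le> (\<Sum>p\<in>{p. p permutes J}. c ^ card J)"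
  proof (intro sum_mono)
    fix p assume "p \<in> {p. p permutes J}"
    then have p: "p permutes J" by simp
    have "(\<Prod>i = 0..<n. X $$ (i, p i)) = (\<Prod>i\<in>J. X $$ (i, p i))"
      using J p cols by (intro prod.mono_neutral_right) (auto simp: permutes_def)
    moreover have "cmod (\<Prod>i\<in>J. X $$ (i, p i)) \<le> (\<Prod>i\<in>J. c)"
      unfolding prod_norm[symmetric]
    proof (intro prod_mono conjI norm_ge_zero entries)
      fix i assume "i \<in> J"
      then show "i < n" "p i < n" using J permutes_in_image[OF p, of i] by auto
    qed
    ultimately show "cmod (t p) \<le> c ^ card J"
      by (simp add: t_def norm_mult sign_def)
  qed
  also have "\<dots> = fact (card J) * c ^ card J"
    using card_permutations[OF refl finJ] by simp
  finally show ?thesis .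
qed

section \<open>Counting eigenvalues of a perturbed identity\<close>

lemma norm_prod_list_map: "cmod (\<Prod>a\<leftarrow>as. f a) = (\<Prod>a\<leftarrow>as. cmod (f a))"
  by (induction as) (auto simp: norm_mult)

text \<open>A form of Jensen's inequality. In the variable \<open>w = 1 / z\<close> the quotient of the
  two products is holomorphic on the disk \<open>|w| \<le> 1 / q\<close> and equals \<open>1\<close> at the origin. Each factor
  \<open>1 - w a\<close> with a zero well inside the disk is traded for its reflection in the bounding circle,
  \<open>w q - cnj a / q\<close>, which has the same modulus on that circle but modulus
  \<open>|a| / q \<ge> 2\<close> at the origin. The maximum modulus principle compares the two places.\<close>

lemma count_large_roots:
  fixes as bs :: "complex list"
  assumes len: "length as = length bs" and q: "0 < q"
    and bs: "\<And>b. b \<in> set bs \<Longrightarrow> cmod b < q"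
    and le: "\<And>z. cmod z = q \<Longrightarrow> cmod (\<Prod>a\<leftarrow>as. z - a) \<le> K * cmod (\<Prod>b\<leftarrow>bs. z - b)"
  shows "2 ^ length (filter (\<lambda>a. 2 * q \<le> cmod a) as) \<le> K"
proof -
  define g where
    "g a w = (if 2 * q \<le> cmod a then w * of_real q - cnj a / of_real q else 1 - w * a)" for a w
  define G where "G w = (\<Prod>a\<leftarrow>as. g a w)" for w
  define D where "D w = (\<Prod>b\<leftarrow>bs. 1 - w * b)" for w
  define S :: "complex set" where "S = cball 0 (1 / q)"
  have Dnz: "D w \<noteq> 0" if "w \<in> S" for w
  proof -
    have "1 - w * b \<noteq> 0" if "b \<in> set bs" for b
    proof
      assume "1 - w * b = 0"
      then have "1 = cmod w * cmod b" by (metis eq_iff_diff_eq_0 norm_mult norm_one)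
      also have "\<dots> \<le> 1 / q * cmod b"
        using \<open>w \<in> S\<close> unfolding S_def by (intro mult_right_mono) auto
      also have "\<dots> < 1 / q * q" using bs[OF that] q by (intro mult_strict_left_mono) auto
      finally show False using q by simp
    qed
    then show ?thesis by (auto simp: D_def prod_list_zero_iff)
  qed
  have holG: "G holomorphic_on UNIV"
    proof -
    have "g a holomorphic_on UNIV" for a
      unfolding g_def[abs_def] by (cases "2 * q \<le> cmod a") (auto intro!: holomorphic_intros)
    then show ?thesis
      unfolding G_def by (induction as) (auto intro!: holomorphic_intros)
  qed
  have holD: "D holomorphic_on UNIV"
    unfolding D_def by (induction bs) (auto intro!: holomorphic_intros)
  have hol: "(\<lambda>w. G w / D w) holomorphic_on S"
    using Dnz by (intro holomorphic_on_divide holomorphic_on_subset[OF holG]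
        holomorphic_on_subset[OF holD]) auto
  have circle: "cmod (G w / D w) \<le> K" if "w \<in> frontier S" for w
  proof -
    have w: "cmod w = 1 / q" using that q by (simp add: S_def)
    define z where "z = 1 / w"
    have z: "cmod z = q" using w by (simp add: z_def norm_divide)
    have wz: "w = 1 / z" by (simp add: z_def)
    have z0: "z \<noteq> 0" using z q by auto
    have one: "cmod (1 - w * a) = cmod (z - a) / q" for a
    proof -
      have "1 - w * a = (z - a) / z" using z0 by (simp add: wz field_simps)
      then show ?thesis using z by (simp add: norm_divide)
    qed
    have two: "cmod (g a w) = cmod (z - a) / q" for a
    proof (cases "2 * q \<le> cmod a")
      case True
      have "z * cnj z = (of_real q)\<^sup>2" using z complex_norm_square[of z] by simp
      then have "w * of_real q = cnj z / of_real q"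
        using z0 q by (simp add: wz field_simps power2_eq_square)
      then have "g a w = cnj (z - a) / of_real q"
        using True by (simp add: g_def diff_divide_distrib)
      then show ?thesis using q by (simp only: norm_divide complex_mod_cnj) simp
    qed (simp add: g_def one)
    have "cmod (G w) = (\<Prod>a\<leftarrow>as. cmod (z - a) / q)"
      by (simp add: G_def norm_prod_list_map two)
    also have "\<dots> = cmod (\<Prod>a\<leftarrow>as. z - a) / q ^ length as"
      by (induction as) (auto simp: norm_mult)
    finally have Gw: "cmod (G w) = cmod (\<Prod>a\<leftarrow>as. z - a) / q ^ length as" .
    have "cmod (D w) = (\<Prod>b\<leftarrow>bs. cmod (z - b) / q)"
      by (simp add: D_def norm_prod_list_map one)
    also have "\<dots> = cmod (\<Prod>b\<leftarrow>bs. z - b) / q ^ length bs"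
      by (induction bs) (auto simp: norm_mult)
    finally have Dw: "cmod (D w) = cmod (\<Prod>b\<leftarrow>bs. z - b) / q ^ length bs" .
    have "cmod (G w) \<le> K * cmod (D w)"
      unfolding Gw Dw len using le[OF z] q by (simp add: divide_right_mono)
    moreover have "D w \<noteq> 0" using Dnz[of w] w by (simp add: S_def)
    ultimately show ?thesis by (simp add: norm_divide field_simps)
  qed
  have "cmod (G 0 / D 0) \<le> K"
    by (rule maximum_modulus_frontier[where S = S])
      (use hol circle q in \<open>auto simp: S_def intro: holomorphic_on_subset holomorphic_on_imp_continuous_on\<close>)
  moreover have "D 0 = 1" unfolding D_def by (induction bs) auto
  moreover have "2 ^ length (filter (\<lambda>a. 2 * q \<le> cmod a) as) \<le> cmod (G 0)"
    unfolding G_def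
  proof (induction as)
    case (Cons a as)
    let ?L = "2 ^ length (filter (\<lambda>a. 2 * q \<le> cmod a) as) :: real"
    let ?P = "cmod (\<Prod>a\<leftarrow>as. g a 0)"
    show ?case
    proof (cases "2 * q \<le> cmod a")
      case True
      then have "2 \<le> cmod (g a 0)" using q by (simp add: g_def norm_divide field_simps)
      then have "2 * ?L \<le> cmod (g a 0) * ?P" using Cons by (intro mult_mono) auto
      with True show ?thesis by (simp add: norm_mult)
    next
      case False
      with Cons show ?thesis by (simp add: norm_mult g_def)
    qed
  qed simp
  ultimately show ?thesis by simp
qed

lemma poly_char_poly_det:
  fixes A :: "complex mat"
  assumes "A \<in> carrier_mat n n"
  shows "poly (char_poly A) z = Determinant.det (z \<cdot>\<^sub>m 1\<^sub>m n - A)"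
proof -
  have "- char_matrix A z = z \<cdot>\<^sub>m 1\<^sub>m n - A"
    using assms by (intro eq_matI) (auto simp: char_matrix_def)
  then show ?thesis by (simp add: char_poly_matrix[OF assms])
qed

lemma poly_linear_factors: "poly (\<Prod>a\<leftarrow>as. [:- a, 1:]) z = (\<Prod>a\<leftarrow>as. z - a)"
  for z :: complex
  by (induction as) (auto simp: algebra_simps)

lemma order_linear_factors: "order z (\<Prod>a\<leftarrow>as. [:- a, 1:]) = count_list as z"
  for z :: complex
proof (induction as)
  case (Cons a as)
  have "(\<Prod>a\<leftarrow>as. [:- a, 1:]) \<noteq> 0" by (auto simp: prod_list_zero_iff)
  moreover have "order z [:- a, 1:] = (if a = z then 1 else 0)"
    using order_power_n_n[of a 1] by (auto intro: order_0I)
  ultimately show ?case using Cons by (simp add: order_mult del: mult_pCons_left)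
qed simp

lemma sum_count_list_filter:
  assumes "finite S" "\<And>a. a \<in> set as \<Longrightarrow> P a \<longleftrightarrow> a \<in> S"
  shows "(\<Sum>z\<in>S. count_list as z) = length (filter P as)"
  using assms
proof (induction as)
  case (Cons a as)
  have "(\<Sum>z\<in>S. count_list (a # as) z) =
      (\<Sum>z\<in>S. count_list as z + (if z = a then 1 else 0))"
    by (intro sum.cong) auto
  also have "\<dots> = (\<Sum>z\<in>S. count_list as z) + (if a \<in> S then 1 else 0)"
    using Cons.prems(1) by (simp add: sum.distrib)
  finally show ?case using Cons by auto
qed simp

text \<open>The characteristic polynomial of \<open>A - 1\<close> factors as
  \<open>det (z - E) * det (1 - S * R)\<close> with the resolvent \<open>S\<close> of \<open>E\<close>, where \<open>1 - S * R\<close> differs from the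
  identity only in the columns \<open>J\<close>. On the circle \<open>|z| = \<epsilon> / 2\<close>, which encloses all eigenvalues of
  \<open>E\<close>, the second determinant is bounded independently of \<open>n\<close>, so the number of roots with
  \<open>|z| \<ge> \<epsilon>\<close> is bounded as well. Multiplicities are the algebraic ones because whole
  characteristic polynomials are compared.\<close>

lemma eigenvalues_off_1_bound:
  fixes A E R :: "complex mat"
  assumes A: "A = 1\<^sub>m n + E + R" and eps: "0 < \<epsilon>"
    and E: "op_bounded n (\<epsilon> / 4) E"
    and R: "op_bounded n M R" and M: "0 \<le> M"
    and J: "J \<subseteq> {0..<n}" "card J \<le> d"
    and cols: "\<And>i k. i < n \<Longrightarrow> k < n \<Longrightarrow> k \<notin> J \<Longrightarrow> R $$ (i, k) = 0"
  shows "real (\<Sum>z\<in>{z \<in> spectrum A. cmod (z - 1) \<ge> \<epsilon>}. order z (char_poly A))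
           \<le> fact d * (1 + 4 * M / \<epsilon>) ^ d"
proof -
  note Ec = op_boundedD(1)[OF E] and Rc = op_boundedD(1)[OF R]
  have Ac: "A \<in> carrier_mat n n" unfolding A using Ec Rc by simp
  obtain as where as: "char_poly A = (\<Prod>a\<leftarrow>as. [:- a, 1:])" "length as = n"
    using char_poly_factorized[OF Ac] by blast
  obtain bs where bs: "char_poly E = (\<Prod>a\<leftarrow>bs. [:- a, 1:])" "length bs = n"
    using char_poly_factorized[OF Ec] by blast
  define c where "c = 1 + 4 * M / \<epsilon>"
  have c: "1 \<le> c" using M eps by (simp add: c_def)
  define K where "K = fact d * c ^ d"
  have "2 ^ length (filter (\<lambda>a. 2 * (\<epsilon> / 2) \<le> cmod a) (map (\<lambda>a. a - 1) as)) \<le> K"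
  proof (rule count_large_roots[of _ bs])
    fix b assume "b \<in> set bs"
    then have "poly (char_poly E) b = 0"
      unfolding bs poly_linear_factors by (auto simp: prod_list_zero_iff)
    then have "\<not> \<epsilon> / 4 < cmod b"
      using det_nonzero_outside_bound[OF E] by (auto simp: poly_char_poly_det[OF Ec])
    then show "cmod b < \<epsilon> / 2" using eps by simp
  next
    fix z assume z: "cmod z = \<epsilon> / 2"
    then have "\<epsilon> / 4 < cmod z" using eps by simp
    from resolvent_op_bounded[OF E this] obtain S where
      S: "op_bounded n (1 / (cmod z - \<epsilon> / 4)) S" and inv: "(z \<cdot>\<^sub>m 1\<^sub>m n - E) * S = 1\<^sub>m n"
      by blast
    note Sc = op_boundedD(1)[OF S]
    have "1 / (cmod z - \<epsilon> / 4) = 4 / \<epsilon>" unfolding z using eps by (simp add: field_simps)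
    with S have S': "op_bounded n (4 / \<epsilon>) S" by simp
    define X where "X = 1\<^sub>m n - S * R"
    have SRc: "S * R \<in> carrier_mat n n" using Sc Rc by simp
    have Xc: "X \<in> carrier_mat n n" unfolding X_def using SRc by (simp add: minus_carrier_mat)
    have SR: "op_bounded n (4 / \<epsilon> * M) (S * R)"
      using op_bounded_mult[OF S' R] eps by simp
    have SR0: "(S * R) $$ (i, k) = 0" if "i < n" "k < n" "k \<notin> J" for i k
      using that Sc Rc cols by (auto simp: scalar_prod_def)
    have factor: "(z + 1) \<cdot>\<^sub>m 1\<^sub>m n - A = (z \<cdot>\<^sub>m 1\<^sub>m n - E) * X"
    proof -
      have "(z \<cdot>\<^sub>m 1\<^sub>m n - E) * X = (z \<cdot>\<^sub>m 1\<^sub>m n - E) * 1\<^sub>m n - (z \<cdot>\<^sub>m 1\<^sub>m n - E) * (S * R)"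
        unfolding X_def using Ec SRc by (intro mult_minus_distrib_mat) (auto simp: minus_carrier_mat)
      also have "(z \<cdot>\<^sub>m 1\<^sub>m n - E) * (S * R) = (z \<cdot>\<^sub>m 1\<^sub>m n - E) * S * R"
        using Ec Sc Rc by (intro assoc_mult_mat[symmetric]) (auto simp: minus_carrier_mat)
      also have "\<dots> = R" using inv Rc by simp
      also have "(z \<cdot>\<^sub>m 1\<^sub>m n - E) * 1\<^sub>m n = z \<cdot>\<^sub>m 1\<^sub>m n - E"
        using Ec by (intro right_mult_one_mat) (auto simp: minus_carrier_mat)
      finally show ?thesis
        unfolding A using Ec Rc by (intro eq_matI) (auto simp: algebra_simps)
    qed
    have "cmod (Determinant.det X) \<le> fact (card J) * c ^ card J"
    proof (rule det_bound_few_columns[OF Xc J(1)])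
      fix i k assume ik: "i < n" "k < n"
      show "X $$ (i, k) = (if i = k then 1 else 0)" if "k \<notin> J"
        using SR0[OF ik that] ik SRc Sc Rc by (simp add: X_def)
      have "X $$ (i, k) = 1\<^sub>m n $$ (i, k) - (S * R) $$ (i, k)"
        unfolding X_def using ik Sc Rc by (intro index_minus_mat) auto
      then have "cmod (X $$ (i, k)) \<le> cmod (1\<^sub>m n $$ (i, k)) + cmod ((S * R) $$ (i, k))"
        by (simp only: norm_triangle_ineq4)
      also have "\<dots> \<le> c"
        using op_bounded_entry[OF SR ik] ik by (auto simp: c_def simp del: index_mult_mat)
      finally show "cmod (X $$ (i, k)) \<le> c" .
    qed
    also have "\<dots> \<le> K"
      unfolding K_def using c J(2) by (intro mult_mono fact_mono power_increasing) auto
    finally have detX: "cmod (Determinant.det X) \<le> K" .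
    have "(\<Prod>a\<leftarrow>map (\<lambda>a. a - 1) as. z - a) = poly (char_poly A) (z + 1)"
      unfolding as poly_linear_factors by (simp add: o_def algebra_simps)
    also have "\<dots> = Determinant.det (z \<cdot>\<^sub>m 1\<^sub>m n - E) * Determinant.det X"
      unfolding poly_char_poly_det[OF Ac] factor
      using Ec Xc by (intro Determinant.det_mult[of _ n]) (auto simp: minus_carrier_mat)
    also have "Determinant.det (z \<cdot>\<^sub>m 1\<^sub>m n - E) = (\<Prod>b\<leftarrow>bs. z - b)"
      unfolding poly_char_poly_det[OF Ec, symmetric] bs poly_linear_factors ..
    finally show "cmod (\<Prod>a\<leftarrow>map (\<lambda>a. a - 1) as. z - a) \<le> K * cmod (\<Prod>b\<leftarrow>bs. z - b)"
      using detX by (simp add: norm_mult mult.commute mult_right_mono)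
  qed (use as bs eps in auto)
  \<comment> \<open>the roots of the characteristic polynomial were shifted by one to those of \<open>A - 1\<close>\<close>
  then have K: "2 ^ length (filter (\<lambda>a. \<epsilon> \<le> cmod (a - 1)) as) \<le> K"
    by (simp add: filter_map o_def)
  have "(\<Sum>z\<in>{z \<in> spectrum A. cmod (z - 1) \<ge> \<epsilon>}. order z (char_poly A))
      = (\<Sum>z\<in>{z \<in> spectrum A. cmod (z - 1) \<ge> \<epsilon>}. count_list as z)"
    by (simp add: as order_linear_factors)
  also have "\<dots> = length (filter (\<lambda>a. \<epsilon> \<le> cmod (a - 1)) as)"
  proof (rule sum_count_list_filter)
    show "finite {z \<in> spectrum A. cmod (z - 1) \<ge> \<epsilon>}"
      using card_finite_spectrum(1)[OF Ac] by simp
    show "\<epsilon> \<le> cmod (a - 1) \<longleftrightarrow> a \<in> {z \<in> spectrum A. cmod (z - 1) \<ge> \<epsilon>}" if "a \<in> set as" for a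
      using that by (auto simp: spectrum_root_char_poly[OF Ac] as poly_linear_factors
          prod_list_zero_iff)
  qed
  finally have "real (\<Sum>z\<in>{z \<in> spectrum A. cmod (z - 1) \<ge> \<epsilon>}. order z (char_poly A))
      = real (length (filter (\<lambda>a. \<epsilon> \<le> cmod (a - 1)) as))"
    by (rule arg_cong)
  also have "\<dots> \<le> 2 ^ length (filter (\<lambda>a. \<epsilon> \<le> cmod (a - 1)) as)"
    using of_nat_less_two_power[where 'a = real] less_imp_le by blast
  also have "\<dots> \<le> fact d * (1 + 4 * M / \<epsilon>) ^ d" using K by (simp only: K_def c_def)
  finally show ?thesis .
qed

section \<open>Toeplitz and circulant matrices as matrices of averages\<close>

definition wave :: "int \<Rightarrow> real \<Rightarrow> complex" where
  "wave m t = cis (of_int m * t)"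

lemma wave_exp: "wave m t = exp (\<i> * of_int m * of_real t)"
  by (simp add: wave_def cis_conv_exp mult.assoc)

lemma wave_add: "wave (m + k) t = wave m t * wave k t"
  by (simp add: wave_def cis_mult algebra_simps)

lemma wave_0 [simp]: "wave 0 t = 1"
  by (simp add: wave_def)

lemma cnj_wave [simp]: "cnj (wave m t) = wave (- m) t"
  by (simp add: wave_def cis_cnj)

lemma norm_wave [simp]: "cmod (wave m t) = 1"
  by (simp add: wave_def)

lemma continuous_wave [continuous_intros]: "continuous_on S (wave m)"
  unfolding wave_def[abs_def] by (intro continuous_intros)

lemma wave_periodic: "wave m (t + 2 * pi) = wave m t"
proof -
  have "wave m (t + 2 * pi) = wave m t * cis (2 * pi * of_int m)"
    by (simp add: wave_def cis_mult algebra_simps)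
  then show ?thesis using cis_multiple_2pi[of "of_int m"] by simp
qed

text \<open>Toeplitz matrices arise from the mean over the circle, circulant ones from the mean
  over the grid of \<open>n\<close>-th roots of unity. All that their norm estimates use is that these means are
  positive linear functionals under which the waves of degree \<open>0, \<dots>, n - 1\<close> are orthonormal.
  Positivity is stated for the real part alone, so that it also applies to functions that are not
  real-valued.\<close>

locale averaging =
  fixes n :: nat and avg :: "(real \<Rightarrow> complex) \<Rightarrow> complex"
  assumes avg_add: "continuous_on UNIV g \<Longrightarrow> continuous_on UNIV h \<Longrightarrow>
      avg (\<lambda>t. g t + h t) = avg g + avg h"
    and avg_mult: "continuous_on UNIV g \<Longrightarrow> avg (\<lambda>t. c * g t) = c * avg g"
    and avg_Re_nonneg: "continuous_on UNIV g \<Longrightarrow> (\<And>t. 0 \<le> Re (g t)) \<Longrightarrow> 0 \<le> Re (avg g)"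
    and avg_wave: "\<bar>m\<bar> < int n \<Longrightarrow> avg (wave m) = (if m = 0 then 1 else 0)"
begin

definition avg_matrix :: "(real \<Rightarrow> complex) \<Rightarrow> complex mat" where
  "avg_matrix g = Matrix.mat n n (\<lambda>(j, k). avg (\<lambda>t. g t * wave (- (int j - int k)) t))"

lemma avg_matrix_carrier: "avg_matrix g \<in> carrier_mat n n"
  by (simp add: avg_matrix_def)

lemma avg_sum:
  assumes "finite S" "\<And>i. i \<in> S \<Longrightarrow> continuous_on UNIV (g i)"
  shows "avg (\<lambda>t. \<Sum>i\<in>S. g i t) = (\<Sum>i\<in>S. avg (g i))"
  using assms
proof (induction S)
  case empty
  show ?case using avg_mult[of "\<lambda>_. 0" 0] by simp
next
  case (insert x S)
  then show ?case by (simp add: avg_add continuous_on_sum)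
qed

lemma avg_matrix_add:
  assumes "continuous_on UNIV g" "continuous_on UNIV h"
  shows "avg_matrix (\<lambda>t. g t + h t) = avg_matrix g + avg_matrix h"
  using assms
  by (intro eq_matI) (auto simp: avg_matrix_def distrib_right intro!: avg_add continuous_intros)

lemma avg_norm_trig_sum:
  "avg (\<lambda>t. (\<Sum>j<n. y j * wave (int j) t) * cnj (\<Sum>j<n. y j * wave (int j) t))
     = of_real (\<Sum>j<n. (cmod (y j))\<^sup>2)"
proof -
  have "avg (\<lambda>t. (\<Sum>j<n. y j * wave (int j) t) * cnj (\<Sum>j<n. y j * wave (int j) t))
      = avg (\<lambda>t. \<Sum>j<n. \<Sum>k<n. (y j * cnj (y k)) * wave (int j - int k) t)"
    by (simp add: sum_product wave_add[of _ "- _", simplified] algebra_simps)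
  also have "\<dots> = (\<Sum>j<n. \<Sum>k<n. y j * cnj (y k) * avg (wave (int j - int k)))"
    by (simp add: avg_sum avg_mult continuous_intros)
  also have "\<dots> = (\<Sum>j<n. \<Sum>k<n. if k = j then y j * cnj (y j) else 0)"
    by (intro sum.cong refl) (subst avg_wave, auto)
  also have "\<dots> = of_real (\<Sum>j<n. (cmod (y j))\<^sup>2)"
    by (simp add: complex_norm_square del: of_real_power)
  finally show ?thesis .
qed

text \<open>With the trigonometric polynomials \<open>X\<close> and \<open>Y\<close> whose coefficients are those of \<open>x\<close>
  and of \<open>y = A x\<close>, the vector \<open>y\<close> consists of the Fourier coefficients of \<open>g X\<close>; this is Bessel's
  inequality \<open>\<parallel>y\<parallel>\<^sup>2 \<le> avg (|g X|\<^sup>2) \<le> s\<^sup>2 \<parallel>x\<parallel>\<^sup>2\<close>.\<close>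

lemma avg_matrix_op_bounded:
  assumes g: "continuous_on UNIV g" and s: "\<And>t. cmod (g t) \<le> s"
  shows "op_bounded n s (avg_matrix g)"
  unfolding op_bounded_def
proof (intro conjI ballI avg_matrix_carrier)
  fix x :: "complex Matrix.vec" assume x: "x \<in> carrier_vec n"
  define y where "y = avg_matrix g *\<^sub>v x"
  have y: "y \<in> carrier_vec n" using avg_matrix_carrier[of g] x by (simp add: y_def)
  have s0: "0 \<le> s" using s[of 0] norm_ge_zero order_trans by blast
  define X where "X t = (\<Sum>j<n. x $ j * wave (int j) t)" for t
  define Y where "Y t = (\<Sum>j<n. y $ j * wave (int j) t)" for t
  have contX: "continuous_on UNIV X" and contY: "continuous_on UNIV Y"
    unfolding X_def[abs_def] Y_def[abs_def] by (intro continuous_intros)+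
  have contg: "continuous_on UNIV (\<lambda>t. g t * h t)" if "continuous_on UNIV h" for h
    using that g by (intro continuous_intros)
  define N where "N v = (\<Sum>j<n. (cmod (v $ j))\<^sup>2)" for v :: "complex Matrix.vec"
  have yj: "y $ j = avg (\<lambda>t. g t * X t * wave (- int j) t)" if "j < n" for j
  proof -
    have "y $ j = (\<Sum>k<n. avg (\<lambda>t. g t * wave (- (int j - int k)) t) * x $ k)"
      using that x by (simp add: y_def avg_matrix_def scalar_prod_def atLeast0LessThan)
    also have "\<dots> = (\<Sum>k<n. avg (\<lambda>t. x $ k * (g t * wave (- (int j - int k)) t)))"
      by (intro sum.cong refl) (subst avg_mult, auto intro!: continuous_intros contg)
    also have "\<dots> = avg (\<lambda>t. \<Sum>k<n. x $ k * (g t * wave (- (int j - int k)) t))"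
      by (subst avg_sum) (auto intro!: continuous_intros contg)
    also have "(\<lambda>t. \<Sum>k<n. x $ k * (g t * wave (- (int j - int k)) t))
        = (\<lambda>t. g t * X t * wave (- int j) t)"
    proof
      fix t
      have "wave (- (int j - int k)) t = wave (int k) t * wave (- int j) t" for k
        by (simp flip: wave_add)
      then show "(\<Sum>k<n. x $ k * (g t * wave (- (int j - int k)) t)) = g t * X t * wave (- int j) t"
        by (simp add: X_def sum_distrib_left sum_distrib_right mult_ac)
    qed
    finally show ?thesis .
  qed
  have cross: "avg (\<lambda>t. g t * X t * cnj (Y t)) = of_real (N y)"
  proof -
    have "(\<lambda>t. g t * X t * cnj (Y t))
        = (\<lambda>t. \<Sum>j<n. cnj (y $ j) * (g t * X t * wave (- int j) t))"
      by (simp add: Y_def sum_distrib_left mult_ac)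
    then have "avg (\<lambda>t. g t * X t * cnj (Y t))
        = (\<Sum>j<n. avg (\<lambda>t. cnj (y $ j) * (g t * X t * wave (- int j) t)))"
      by (simp, subst avg_sum) (auto intro!: continuous_intros contg contX g)
    also have "\<dots> = (\<Sum>j<n. cnj (y $ j) * y $ j)"
      by (intro sum.cong refl) (subst avg_mult, auto simp: yj intro!: continuous_intros g contX)
    also have "\<dots> = of_real (N y)"
      by (simp add: N_def complex_norm_square mult.commute del: of_real_power)
    finally show ?thesis .
  qed
  \<comment> \<open>pointwise, \<open>2 Re (g X cnj Y) \<le> s\<^sup>2 |X|\<^sup>2 + |Y|\<^sup>2\<close>, so the real part of \<open>H\<close> is nonnegative;
    its average is \<open>s\<^sup>2 \<parallel>x\<parallel>\<^sup>2 - \<parallel>y\<parallel>\<^sup>2\<close>\<close>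
  define H where "H t = of_real (s\<^sup>2) * (X t * cnj (X t)) + (Y t * cnj (Y t) + (-2) * (g t * X t * cnj (Y t)))"
    for t
  have contH: "continuous_on UNIV H"
    unfolding H_def[abs_def] by (intro continuous_intros contX contY g)
  have "0 \<le> Re (H t)" for t
  proof -
    have "Re (g t * X t * cnj (Y t)) \<le> cmod (g t * X t) * cmod (Y t)"
      by (metis complex_Re_le_cmod complex_mod_cnj norm_mult)
    also have "\<dots> \<le> (s * cmod (X t)) * cmod (Y t)"
      using s[of t] by (intro mult_right_mono) (auto simp: norm_mult intro: mult_right_mono)
    finally have "2 * Re (g t * X t * cnj (Y t)) \<le> 2 * (s * cmod (X t)) * cmod (Y t)" by simp
    also have "\<dots> \<le> (s * cmod (X t))\<^sup>2 + (cmod (Y t))\<^sup>2"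
      by (rule sum_squares_bound)
    finally have "2 * Re (g t * X t * cnj (Y t)) \<le> s\<^sup>2 * (cmod (X t))\<^sup>2 + (cmod (Y t))\<^sup>2"
      by (simp add: power_mult_distrib)
    moreover have "Re (H t) = s\<^sup>2 * (cmod (X t))\<^sup>2 + (cmod (Y t))\<^sup>2 - 2 * Re (g t * X t * cnj (Y t))"
    proof -
      have "Re (of_real a * of_real b + (of_real c + (-2) * z)) = a * b + c - 2 * Re z"
        for a b c :: real and z by simp
      then show ?thesis unfolding H_def complex_norm_square[symmetric] by blast
    qed
    ultimately show ?thesis by simp
  qed
  then have "0 \<le> Re (avg H)" using avg_Re_nonneg contH by blast
  also have "avg H = of_real (s\<^sup>2) * avg (\<lambda>t. X t * cnj (X t))
      + (avg (\<lambda>t. Y t * cnj (Y t)) + (-2) * avg (\<lambda>t. g t * X t * cnj (Y t)))"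
    unfolding H_def[abs_def]
    by (subst avg_add avg_mult; (intro continuous_intros contX contY g)?)+ simp
  also have "avg (\<lambda>t. X t * cnj (X t)) = of_real (N x)"
    unfolding X_def N_def by (rule avg_norm_trig_sum)
  also have "avg (\<lambda>t. Y t * cnj (Y t)) = of_real (N y)"
    unfolding Y_def N_def by (rule avg_norm_trig_sum)
  finally have "N y \<le> s\<^sup>2 * N x" unfolding cross by simp
  then have "sqrt (N y) \<le> s * sqrt (N x)"
    using s0 by (metis real_sqrt_le_mono real_sqrt_mult real_sqrt_unique)
  then show "vnorm (avg_matrix g *\<^sub>v x) \<le> s * vnorm x"
    using x y by (simp add: vnorm_def L2_set_def N_def flip: y_def)
qed

end

definition circle_mean :: "(real \<Rightarrow> complex) \<Rightarrow> complex" where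
  "circle_mean g = 1 / (2 * complex_of_real pi) * integral {-pi..pi} g"

lemma circle_mean_wave: "circle_mean (wave m) = (if m = 0 then 1 else 0)"
proof (cases "m = 0")
  case True
  then show ?thesis by (simp add: circle_mean_def wave_def[abs_def] scaleR_conv_of_real)
next
  case False
  let ?F = "\<lambda>t. wave m t / (\<i> * of_int m)"
  have deriv: "(?F has_vector_derivative wave m t) (at t within {-pi..pi})" for t
  proof -
    have "((\<lambda>z. exp (\<i> * of_int m * z) / (\<i> * of_int m)) has_field_derivative
        exp (\<i> * of_int m * of_real t)) (at (of_real t))"
      using False by (auto intro!: derivative_eq_intros)
    from has_vector_derivative_real_field[OF this] show ?thesis
      by (simp add: wave_exp)
  qed
  have "(wave m has_integral (?F pi - ?F (- pi))) {-pi..pi}"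
    by (rule fundamental_theorem_of_calculus) (use deriv in auto)
  moreover have "?F pi = ?F (- pi)" using wave_periodic[of m "- pi"] by simp
  ultimately show ?thesis using False by (simp add: circle_mean_def integral_unique)
qed

lemma averaging_circle_mean: "averaging n circle_mean"
proof
  have int: "g integrable_on {-pi..pi}" if "continuous_on UNIV g" for g :: "real \<Rightarrow> complex"
    using that by (intro integrable_continuous_real continuous_on_subset[OF that]) auto
  fix g h :: "real \<Rightarrow> complex" and c :: complex
  assume g: "continuous_on UNIV g"
  show "circle_mean (\<lambda>t. g t + h t) = circle_mean g + circle_mean h" if "continuous_on UNIV h"
    using int[OF g] int[OF that]
    by (simp add: circle_mean_def integral_add distrib_left)
  show "circle_mean (\<lambda>t. c * g t) = c * circle_mean g"
    by (simp add: circle_mean_def)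
  show "0 \<le> Re (circle_mean g)" if "\<And>t. 0 \<le> Re (g t)"
  proof -
    have "Re (integral {-pi..pi} g) = integral {-pi..pi} (\<lambda>t. Re (g t))"
      using integral_linear[OF int[OF g] bounded_linear_Re] by (simp add: o_def)
    moreover have "0 \<le> integral {-pi..pi} (\<lambda>t. Re (g t))"
      using that by (intro integral_nonneg integrable_continuous_real continuous_intros
          continuous_on_subset[OF g]) auto
    moreover have "circle_mean g = of_real (1 / (2 * pi)) * integral {-pi..pi} g"
      by (simp add: circle_mean_def)
    ultimately show ?thesis by (simp only: Re_complex_of_real Im_complex_of_real times_complex.simps) simp
  qed
qed (simp add: circle_mean_wave)

definition grid_mean :: "nat \<Rightarrow> (real \<Rightarrow> complex) \<Rightarrow> complex" where
  "grid_mean n g = (\<Sum>l<n. g (2 * pi * real l / real n)) / of_nat n"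

lemma grid_mean_wave:
  assumes "\<bar>m\<bar> < int n"
  shows "grid_mean n (wave m) = (if m = 0 then 1 else 0)"
proof -
  have n: "0 < n" using assms by linarith
  show ?thesis
  proof (cases "m = 0")
    case True
    then show ?thesis using n by (simp add: grid_mean_def)
  next
    case False
    define w where "w = cis (2 * pi * of_int m / of_nat n)"
    have pow: "wave m (2 * pi * real l / real n) = w ^ l" for l
      by (simp add: w_def wave_def Complex.DeMoivre mult_ac)
    have wn: "w ^ n = 1"
      using n cis_multiple_2pi[of "of_int m"] by (simp add: w_def Complex.DeMoivre)
    have w1: "w \<noteq> 1"
    proof
      assume "w = 1"
      then have "cos (2 * pi * of_int m / of_nat n) = 1"
        by (metis cis.simps(1) w_def one_complex.simps(1))
      then obtain k :: int where "2 * pi * of_int m / real n = of_int k * 2 * pi"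
        using cos_one_2pi_int by auto
      then have "real_of_int m = real_of_int (k * int n)" using n by (simp add: field_simps)
      then have "m = k * int n" by linarith
      with assms False show False by (simp add: abs_mult)
    qed
    have "(\<Sum>l<n. w ^ l) = 0" using sum_gp_strict[of w n] w1 wn by simp
    then show ?thesis using False by (simp add: grid_mean_def pow)
  qed
qed

lemma averaging_grid_mean: "averaging n (grid_mean n)"
proof
  show "0 \<le> Re (grid_mean n g)" if "\<And>t. 0 \<le> Re (g t)" for g
    using that by (simp add: grid_mean_def sum_nonneg)
qed (simp_all add: grid_mean_wave, simp_all add: grid_mean_def sum.distrib add_divide_distrib sum_distrib_left)

lemma toeplitz_eq_avg_matrix: "toeplitz n g = averaging.avg_matrix n circle_mean g"
proof -
  interpret averaging n circle_mean by (rule averaging_circle_mean)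
  show ?thesis
    unfolding toeplitz_def avg_matrix_def fourier_coefficient_def circle_mean_def
    by (intro cong_mat refl) (simp add: wave_exp[abs_def] exp_minus[symmetric] algebra_simps)
qed

lemma fourier_matrix_entry:
  assumes "j < n" "k < n"
  shows "fourier_matrix n $$ (j, k) = wave (int j) (2 * pi * real k / real n) / of_real (sqrt (real n))"
proof -
  have "exp (2 * complex_of_real pi * \<i> / of_nat n) ^ (j * k) = wave (int j) (2 * pi * real k / real n)"
    by (simp add: wave_exp exp_of_nat_mult[symmetric] mult_ac)
  then show ?thesis using assms by (simp add: fourier_matrix_def)
qed

lemma fourier_matrix_carrier: "fourier_matrix n \<in> carrier_mat n n"
  by (simp add: fourier_matrix_def)

lemma adjoint_fourier_matrix_carrier: "mat_adjoint (fourier_matrix n) \<in> carrier_mat n n"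
  by (simp add: fourier_matrix_def mat_adjoint_def mat_of_rows_def)

lemma adjoint_entry:
  assumes "A \<in> carrier_mat n n" "j < n" "k < n"
  shows "mat_adjoint A $$ (j, k) = cnj (A $$ (k, j))"
  using assms unfolding mat_adjoint_def by (simp add: mat_of_rows_index)

lemma wave_grid_swap:
  "wave (int j) (2 * pi * real k / real n) = wave (int k) (2 * pi * real j / real n)"
  by (simp add: wave_def mult_ac)

lemma circulant_eq_avg_matrix: "circulant n g = averaging.avg_matrix n (grid_mean n) g"
proof -
  interpret averaging n "grid_mean n" by (rule averaging_grid_mean)
  note Fc = fourier_matrix_carrier[of n] adjoint_fourier_matrix_carrier[of n]
  show ?thesis
  proof (rule eq_matI)
    fix j k assume "j < dim_row (avg_matrix g)" "k < dim_col (avg_matrix g)"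
    then have jk: "j < n" "k < n" using avg_matrix_carrier[of g] by auto
    let ?t = "\<lambda>l. 2 * pi * real l / real n"
    have "circulant n g $$ (j, k) =
        (\<Sum>l<n. mat_adjoint (fourier_matrix n) $$ (j, l) * g (?t l) * fourier_matrix n $$ (l, k))"
      unfolding circulant_def mat_diag_mult_right[OF Fc(2)]
      using jk Fc by (simp add: scalar_prod_def atLeast0LessThan)
    also have "\<dots> = (\<Sum>l<n. g (?t l) * wave (- (int j - int k)) (?t l) / of_nat n)"
    proof (intro sum.cong refl)
      fix l assume "l \<in> {..<n}"
      then have l: "l < n" by simp
      have "complex_of_real (sqrt (real n)) * complex_of_real (sqrt (real n)) = of_nat n"
        by (simp flip: of_real_mult)
      moreover have "wave (- (int j - int k)) (?t l) = wave (- int j) (?t l) * wave (int k) (?t l)"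
        by (simp flip: wave_add)
      ultimately show "mat_adjoint (fourier_matrix n) $$ (j, l) * g (?t l) * fourier_matrix n $$ (l, k)
          = g (?t l) * wave (- (int j - int k)) (?t l) / of_nat n"
        using jk l
        by (simp add: adjoint_entry[OF Fc(1)] fourier_matrix_entry wave_grid_swap[of l])
    qed
    also have "\<dots> = avg_matrix g $$ (j, k)"
      using jk by (simp add: avg_matrix_def grid_mean_def sum_divide_distrib)
    finally show "circulant n g $$ (j, k) = avg_matrix g $$ (j, k)" .
  qed (use Fc avg_matrix_carrier[of g] in \<open>auto simp: circulant_def\<close>)
qed

lemma circulant_carrier: "circulant n g \<in> carrier_mat n n"
  unfolding circulant_eq_avg_matrix by (rule averaging.avg_matrix_carrier[OF averaging_grid_mean])

text \<open>The left-hand side is the circulant matrix of the constant \<open>1\<close>, whose entries are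
  grid means of waves of degree less than \<open>n\<close>.\<close>

lemma fourier_matrix_unitary:
  "mat_adjoint (fourier_matrix n) * fourier_matrix n = 1\<^sub>m n"
proof -
  interpret averaging n "grid_mean n" by (rule averaging_grid_mean)
  note Fc = fourier_matrix_carrier[of n] adjoint_fourier_matrix_carrier[of n]
  have "mat_adjoint (fourier_matrix n) * fourier_matrix n = circulant n (\<lambda>_. 1)"
    unfolding circulant_def using Fc by simp
  also have "\<dots> = 1\<^sub>m n"
    unfolding circulant_eq_avg_matrix
    by (intro eq_matI) (auto simp: avg_matrix_def, (subst grid_mean_wave; auto)+)
  finally show ?thesis .
qed

lemma circulant_mult: "circulant n g * circulant n h = circulant n (\<lambda>t. g t * h t)"
proof -
  define F where "F = fourier_matrix n"
  define H where "H = mat_adjoint F"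
  have c: "F \<in> carrier_mat n n" "H \<in> carrier_mat n n"
    using fourier_matrix_carrier adjoint_fourier_matrix_carrier by (auto simp: F_def H_def)
  have FH: "F * H = 1\<^sub>m n"
    using mat_mult_left_right_inverse[OF c(2,1)] fourier_matrix_unitary by (simp add: F_def H_def)
  let ?D = "\<lambda>g. mat_diag n (\<lambda>k. g (2 * pi * real k / real n))"
  have D: "?D g \<in> carrier_mat n n" for g :: "real \<Rightarrow> complex" by simp
  have sq: "A * B \<in> carrier_mat n n" if "A \<in> carrier_mat n n" "B \<in> carrier_mat n n"
    for A B :: "complex mat" using that by simp
  have inner: "(H * ?D h) * F = H * (?D h * F)"
    by (intro assoc_mult_mat[of _ n n _ n _ n] sq c D)
  have "(H * ?D g * F) * (H * ?D h * F) = (H * ?D g) * (F * (H * (?D h * F)))"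
    unfolding inner by (intro assoc_mult_mat[of _ n n _ n _ n] sq c D)
  also have "F * (H * (?D h * F)) = (F * H) * (?D h * F)"
    by (intro assoc_mult_mat[of _ n n _ n _ n, symmetric] sq c D)
  also have "\<dots> = ?D h * F"
    unfolding FH by (rule left_mult_one_mat[OF sq[OF D c(1)]])
  also have "H * ?D g * (?D h * F) = H * ?D g * ?D h * F"
    by (intro assoc_mult_mat[of _ n n _ n _ n, symmetric] sq c D)
  also have "H * ?D g * ?D h = H * (?D g * ?D h)"
    by (intro assoc_mult_mat[of _ n n _ n _ n] sq c D)
  finally show ?thesis unfolding circulant_def F_def H_def by simp
qed

lemma circulant_one: "circulant n (\<lambda>_. 1) = 1\<^sub>m n"
  unfolding circulant_def
  using fourier_matrix_unitary adjoint_fourier_matrix_carrier[of n] by simp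

lemma the_mat_inverse_eq:
  fixes A B :: "complex mat"
  assumes A: "A \<in> carrier_mat n n" and B: "B \<in> carrier_mat n n" and AB: "A * B = 1\<^sub>m n"
  shows "the (mat_inverse A) = B"
proof -
  have BA: "B * A = 1\<^sub>m n" by (rule mat_mult_left_right_inverse[OF A B AB])
  have "A \<in> Units (ring_mat TYPE(complex) n ())"
    using A B AB BA by (auto simp: Units_def ring_mat_def)
  then obtain B' where B': "mat_inverse A = Some B'"
    using mat_inverse(1)[OF A, where b = "()"] by (cases "mat_inverse A") auto
  then have inv: "A * B' = 1\<^sub>m n" "B' \<in> carrier_mat n n" using mat_inverse(2)[OF A B'] by auto
  have "B' = B * A * B'" using BA inv by simp
  also have "\<dots> = B * (A * B')" by (rule assoc_mult_mat[OF B A inv(2)])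
  also have "\<dots> = B" using B inv by simp
  finally show ?thesis using B' by simp
qed

lemma the_mat_inverse_circulant:
  assumes "\<And>t. f t \<noteq> 0"
  shows "the (mat_inverse (circulant n f)) = circulant n (\<lambda>t. 1 / f t)"
  by (rule the_mat_inverse_eq[OF circulant_carrier circulant_carrier])
    (use assms in \<open>simp add: circulant_mult circulant_one\<close>)

section \<open>Trigonometric polynomials\<close>

inductive trig_poly :: "(real \<Rightarrow> complex) \<Rightarrow> bool" where
  monomial: "trig_poly (\<lambda>t. c * wave m t)"
| sum: "trig_poly p \<Longrightarrow> trig_poly q \<Longrightarrow> trig_poly (\<lambda>t. p t + q t)"

lemma trig_poly_const: "trig_poly (\<lambda>t. c)"
  using trig_poly.monomial[of c 0] by simp

lemma trig_poly_monomial_mult: "trig_poly p \<Longrightarrow> trig_poly (\<lambda>t. c * wave m t * p t)"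
proof (induction rule: trig_poly.induct)
  case (monomial c' m')
  have "c * wave m t * (c' * wave m' t) = c * c' * wave (m + m') t" for t
    by (simp add: wave_add)
  then show ?case using trig_poly.monomial[of "c * c'" "m + m'"] by (simp only:)
next
  case (sum p q)
  then show ?case by (simp add: distrib_left trig_poly.sum)
qed

lemma trig_poly_mult: "trig_poly p \<Longrightarrow> trig_poly q \<Longrightarrow> trig_poly (\<lambda>t. p t * q t)"
  by (induction rule: trig_poly.induct)
    (simp_all add: trig_poly_monomial_mult distrib_right trig_poly.sum)

lemma trig_poly_continuous: "trig_poly p \<Longrightarrow> continuous_on S p"
  by (induction rule: trig_poly.induct) (auto intro!: continuous_intros)

lemma trig_poly_bounded: "trig_poly p \<Longrightarrow> \<exists>s. \<forall>t. cmod (p t) \<le> s"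
proof (induction rule: trig_poly.induct)
  case (monomial c m)
  show ?case by (rule exI[of _ "cmod c"]) (simp add: norm_mult)
next
  case (sum p q)
  then obtain a b where "cmod (p t) \<le> a" "cmod (q t) \<le> b" for t by blast
  then show ?case by (intro exI[of _ "a + b"]) (auto intro: norm_triangle_mono)
qed

lemma real_polynomial_on_circle:
  fixes h :: "complex \<Rightarrow> real"
  assumes "real_polynomial_function h"
  shows "trig_poly (\<lambda>t. of_real (h (cis t)))"
  using assms
proof (induction rule: real_polynomial_function.induct)
  case (linear h)
  have "of_real (h (cis t)) = (of_real (h 1) - \<i> * of_real (h \<i>)) / 2 * wave 1 t
      + (of_real (h 1) + \<i> * of_real (h \<i>)) / 2 * wave (-1) t" for t
  proof -
    have "cis t = cos t *\<^sub>R 1 + sin t *\<^sub>R \<i>" by (simp add: complex_eq_iff)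
    then have "h (cis t) = h (cos t *\<^sub>R 1 + sin t *\<^sub>R \<i>)" by simp
    also have "\<dots> = cos t * h 1 + sin t * h \<i>"
      using bounded_linear.linear[OF linear] by (simp add: linear_add linear_scale)
    finally have "h (cis t) = cos t * h 1 + sin t * h \<i>" .
    then show ?thesis by (simp add: complex_eq_iff wave_def field_simps)
  qed
  then show ?case
    by (simp only: trig_poly.intros)
next
  case (const c)
  show ?case by (rule trig_poly_const)
qed (simp_all add: trig_poly.sum trig_poly_mult)

lemma periodic_Arg_cis:
  fixes f :: "real \<Rightarrow> complex"
  assumes "\<forall>x. f (x + 2 * pi) = f x"
  shows "f (Arg (cis t)) = f t"
proof -
  interpret periodic_fun_simple f "2 * pi"
    by unfold_locales (use assms in simp)
  have "cis (Arg (cis t)) = cis t" by (simp add: cis_Arg)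
  then have "sin (Arg (cis t)) = sin t \<and> cos (Arg (cis t)) = cos t" by (simp add: complex_eq_iff)
  then obtain k :: int where "Arg (cis t) = t + 2 * pi * of_int k"
    using sin_cos_eq_iff by blast
  then show ?thesis using plus_of_int[of t k] by (simp add: mult_ac)
qed

text \<open>A periodic function factors through the circle, where Stone-Weierstrass supplies a
  polynomial in the two coordinates. The factor \<open>f \<circ> Arg\<close> is continuous also across the cut of
  \<open>Arg\<close>, since \<open>cis\<close> maps compact sets to compact, hence closed, sets.\<close>

lemma trig_poly_dense:
  fixes f :: "real \<Rightarrow> complex"
  assumes per: "\<forall>x. f (x + 2 * pi) = f x" and cont: "continuous_on UNIV f" and e: "0 < e"
  obtains p where "trig_poly p" "\<And>t. cmod (f t - p t) < e"
proof -
  define F where "F z = f (Arg z)" for z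
  have "continuous_on (sphere 0 1) F"
    unfolding continuous_on_closed_vimage[OF closed_sphere]
  proof (intro allI impI)
    fix B :: "complex set" assume B: "closed B"
    have "F -` B \<inter> sphere 0 1 = cis ` ({-pi..pi} \<inter> f -` B)" (is "?L = ?R")
    proof
      show "?L \<subseteq> ?R"
      proof
        fix z assume z: "z \<in> ?L"
        then have "cis (Arg z) = z" by (subst cis_Arg) (auto simp: sgn_div_norm)
        moreover have "Arg z \<in> {-pi..pi} \<inter> f -` B"
          using z Arg_bounded[of z] by (auto simp: F_def)
        ultimately show "z \<in> ?R" by (metis image_eqI)
      qed
      show "?R \<subseteq> ?L" by (auto simp: F_def periodic_Arg_cis[OF per])
    qed
    moreover have "closed (f -` B)"
      using cont B by (simp add: continuous_on_closed_vimage)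
    then have "compact ({-pi..pi} \<inter> f -` B)"
      by (rule compact_Int_closed[OF compact_Icc])
    then have "compact ?R"
      by (intro compact_continuous_image continuous_intros)
    ultimately show "closed ?L" using compact_imp_closed by simp
  qed
  from Stone_Weierstrass_polynomial_function[OF compact_sphere this e] obtain g where
    g: "polynomial_function g" "\<And>z. z \<in> sphere 0 1 \<Longrightarrow> cmod (F z - g z) < e" by blast
  have "trig_poly (\<lambda>t. of_real (Re (g (cis t))) + \<i> * of_real (Im (g (cis t))))"
    using g(1) bounded_linear_Re bounded_linear_Im
      real_polynomial_on_circle[of "Re \<circ> g"] real_polynomial_on_circle[of "Im \<circ> g"]
    by (intro trig_poly.sum trig_poly_mult trig_poly_const) (auto simp: polynomial_function_def o_def)
  then have "trig_poly (\<lambda>t. g (cis t))" by (simp flip: complex_eq)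
  moreover have "cmod (f t - g (cis t)) < e" for t
    using g(2)[of "cis t"] by (simp add: F_def periodic_Arg_cis[OF per])
  ultimately show ?thesis using that by blast
qed

text \<open>The grid mean cannot tell waves apart whose degrees are congruent modulo \<open>n\<close>, so the
  two matrices of a wave of degree \<open>m\<close> differ only where \<open>j - k\<close> is congruent but not equal to \<open>m\<close>. For \<open>j < n\<close> this
  places \<open>k\<close> among the first or the last \<open>|m|\<close> columns.\<close>

lemma trig_poly_toeplitz_eq_circulant:
  assumes "trig_poly p"
  shows "\<exists>d. \<forall>n j k. j < n \<longrightarrow> k < n \<longrightarrow> d \<le> k \<longrightarrow> k + d < n \<longrightarrow>
           toeplitz n p $$ (j, k) = circulant n p $$ (j, k)"
  using assms
proof (induction rule: trig_poly.induct)
  case (monomial c m)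
  show ?case
  proof (intro exI[of _ "nat \<bar>m\<bar>"] allI impI)
    fix n j k
    assume jk: "j < n" "k < n" "nat \<bar>m\<bar> \<le> k" "k + nat \<bar>m\<bar> < n"
    interpret T: averaging n circle_mean by (rule averaging_circle_mean)
    interpret C: averaging n "grid_mean n" by (rule averaging_grid_mean)
    have "wave m t * wave (- (int j - int k)) t = wave (m - (int j - int k)) t" for t
      unfolding wave_add[symmetric] by (simp only: diff_conv_add_uminus)
    moreover have "\<bar>m - (int j - int k)\<bar> < int n" using jk by linarith
    ultimately show "toeplitz n (\<lambda>t. c * wave m t) $$ (j, k) = circulant n (\<lambda>t. c * wave m t) $$ (j, k)"
      using jk T.avg_wave C.avg_wave
      by (simp add: toeplitz_eq_avg_matrix circulant_eq_avg_matrix T.avg_matrix_def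
          C.avg_matrix_def mult.assoc T.avg_mult C.avg_mult continuous_wave)
  qed
next
  case (sum p q)
  from sum.IH obtain a b where
    a: "\<And>n j k. j < n \<Longrightarrow> k < n \<Longrightarrow> a \<le> k \<Longrightarrow> k + a < n \<Longrightarrow>
           toeplitz n p $$ (j, k) = circulant n p $$ (j, k)" and
    b: "\<And>n j k. j < n \<Longrightarrow> k < n \<Longrightarrow> b \<le> k \<Longrightarrow> k + b < n \<Longrightarrow>
           toeplitz n q $$ (j, k) = circulant n q $$ (j, k)" by blast
  show ?case
  proof (intro exI[of _ "max a b"] allI impI)
    fix n j k
    assume jk: "j < n" "k < n" "max a b \<le> k" "k + max a b < n"
    interpret T: averaging n circle_mean by (rule averaging_circle_mean)
    interpret C: averaging n "grid_mean n" by (rule averaging_grid_mean)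
    note cont = sum.hyps[THEN trig_poly_continuous, of UNIV]
    show "toeplitz n (\<lambda>t. p t + q t) $$ (j, k) = circulant n (\<lambda>t. p t + q t) $$ (j, k)"
      using jk a[of j n k] b[of j n k] T.avg_matrix_carrier[of q] C.avg_matrix_carrier[of q]
      by (simp add: toeplitz_eq_avg_matrix circulant_eq_avg_matrix
          T.avg_matrix_add[OF cont] C.avg_matrix_add[OF cont])
  qed
qed

section \<open>Clustering of the preconditioned spectrum\<close>

lemma circulant_op_bounded:
  assumes "continuous_on UNIV g" "\<And>t. cmod (g t) \<le> s"
  shows "op_bounded n s (circulant n g)"
  unfolding circulant_eq_avg_matrix
  by (rule averaging.avg_matrix_op_bounded[OF averaging_grid_mean assms])

lemma toeplitz_op_bounded:
  assumes "continuous_on UNIV g" "\<And>t. cmod (g t) \<le> s"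
  shows "op_bounded n s (toeplitz n g)"
  unfolding toeplitz_eq_avg_matrix
  by (rule averaging.avg_matrix_op_bounded[OF averaging_circle_mean assms])

lemma preconditioned_decomposition:
  fixes f p :: "real \<Rightarrow> complex" and n :: nat
  assumes f: "continuous_on UNIV f" and nz: "\<And>t. f t \<noteq> 0" and p: "continuous_on UNIV p"
  defines "D \<equiv> \<lambda>g. toeplitz n g - circulant n g"
  shows "circulant n (\<lambda>t. 1 / f t) * toeplitz n f
    = 1\<^sub>m n + circulant n (\<lambda>t. 1 / f t) * D (\<lambda>t. f t - p t) + circulant n (\<lambda>t. 1 / f t) * D p"
proof -
  interpret T: averaging n circle_mean by (rule averaging_circle_mean)
  interpret C: averaging n "grid_mean n" by (rule averaging_grid_mean)
  define U where "U = circulant n (\<lambda>t. 1 / f t)"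
  have U: "U \<in> carrier_mat n n" unfolding U_def by (rule circulant_carrier)
  have Tc: "toeplitz n g \<in> carrier_mat n n" for g by (simp add: toeplitz_def)
  note Cc = circulant_carrier[of n]
  have Dc: "D g \<in> carrier_mat n n" for g unfolding D_def using Tc Cc by (simp add: minus_carrier_mat)
  have fp: "continuous_on UNIV (\<lambda>t. f t - p t)" using f p by (intro continuous_intros)
  have "toeplitz n f = toeplitz n (\<lambda>t. f t - p t) + toeplitz n p"
    "circulant n f = circulant n (\<lambda>t. f t - p t) + circulant n p"
    using T.avg_matrix_add[OF fp p] C.avg_matrix_add[OF fp p]
    by (simp_all add: toeplitz_eq_avg_matrix circulant_eq_avg_matrix)
  then have "toeplitz n f = circulant n f + (D (\<lambda>t. f t - p t) + D p)"
    using carrier_matD[OF Tc] carrier_matD[OF Cc] unfolding D_def by (intro eq_matI) auto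
  then have "U * toeplitz n f = U * circulant n f + (U * D (\<lambda>t. f t - p t) + U * D p)"
    using U Cc Dc by (simp add: mult_add_distrib_mat[of U n n _ n])
  also have "U * circulant n f = 1\<^sub>m n"
    using nz by (simp add: U_def circulant_mult circulant_one)
  finally show ?thesis
    using U Dc unfolding U_def[symmetric] by (simp add: assoc_add_mat[of _ n n])
qed

theorem mainTheorem8:
  fixes f :: "real \<Rightarrow> complex"
  assumes periodic: "\<forall>x. f (x + 2 * pi) = f x"
    and continuous: "continuous_on UNIV f"
    and no_zeros: "\<forall>x\<in>{-pi<..pi}. f x \<noteq> 0"
  shows "properly_clustered (\<lambda>n. the (mat_inverse (circulant n f)) * toeplitz n f) 1"
proof -
  have nz: "f t \<noteq> 0" for t
    using no_zeros Arg_bounded[of "cis t"] periodic_Arg_cis[OF periodic, of t] by force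
  have "\<exists>x\<in>{-pi..pi}. \<forall>y\<in>{-pi..pi}. cmod (f x) \<le> cmod (f y)"
    by (intro continuous_attains_inf compact_Icc continuous_intros continuous_on_subset[OF continuous]) auto
  then obtain x where x: "\<And>y. y \<in> {-pi..pi} \<Longrightarrow> cmod (f x) \<le> cmod (f y)" by blast
  define \<mu> where "\<mu> = cmod (f x)"
  have \<mu>: "0 < \<mu>" using nz by (simp add: \<mu>_def)
  have lower: "\<mu> \<le> cmod (f t)" for t
    using x[of "Arg (cis t)"] Arg_bounded[of "cis t"] periodic_Arg_cis[OF periodic, of t]
    by (simp add: \<mu>_def)
  define U where "U n = circulant n (\<lambda>t. 1 / f t)" for n
  have U: "op_bounded n (1 / \<mu>) (U n)" for n
    unfolding U_def
    using nz lower \<mu> continuous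
    by (intro circulant_op_bounded continuous_intros) (auto simp: norm_divide intro: divide_left_mono)
  have inv: "the (mat_inverse (circulant n f)) = U n" for n
    unfolding U_def by (rule the_mat_inverse_circulant[OF nz])
  have Tc: "toeplitz n g \<in> carrier_mat n n" for n g by (simp add: toeplitz_def)
  have bound: "\<exists>c::nat. \<forall>n\<ge>1. (\<Sum>z\<in>{z \<in> spectrum (U n * toeplitz n f). cmod (z - 1) \<ge> \<epsilon>}.
      order z (char_poly (U n * toeplitz n f))) \<le> c" if \<epsilon>: "0 < \<epsilon>" for \<epsilon>
  proof -
    \<comment> \<open>with \<open>\<delta> = \<mu> \<epsilon> / 8\<close> the small part has norm at most \<open>2 \<delta> / \<mu> = \<epsilon> / 4\<close>\<close>
    define \<delta> where "\<delta> = \<mu> * \<epsilon> / 8"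
    have \<delta>: "0 < \<delta>" using \<mu> \<epsilon> by (simp add: \<delta>_def)
    obtain p where p: "trig_poly p" and close: "\<And>t. cmod (f t - p t) < \<delta>"
      using trig_poly_dense[OF periodic continuous \<delta>] by blast
    note pcont = trig_poly_continuous[OF p, of UNIV]
    obtain s where s: "\<And>t. cmod (p t) \<le> s" using trig_poly_bounded[OF p] by blast
    have s0: "0 \<le> s" using s[of 0] norm_ge_zero order_trans by blast
    obtain d where d: "\<And>n j k. j < n \<Longrightarrow> k < n \<Longrightarrow> d \<le> k \<Longrightarrow> k + d < n \<Longrightarrow>
        toeplitz n p $$ (j, k) = circulant n p $$ (j, k)"
      using trig_poly_toeplitz_eq_circulant[OF p] by blast
    define M where "M = 1 / \<mu> * (s + s)"
    define K where "K = fact (2 * d) * (1 + 4 * M / \<epsilon>) ^ (2 * d)"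
    have "real (\<Sum>z\<in>{z \<in> spectrum (U n * toeplitz n f). cmod (z - 1) \<ge> \<epsilon>}.
      order z (char_poly (U n * toeplitz n f))) \<le> K" for n
    proof -
      define D where "D g = toeplitz n g - circulant n g" for g
      define J where "J = {k. k < n \<and> (k < d \<or> n \<le> k + d)}"
      have D: "op_bounded n (r + r) (D g)" if "continuous_on UNIV g" "\<And>t. cmod (g t) \<le> r" for r g
        unfolding D_def
        by (intro op_bounded_minus toeplitz_op_bounded circulant_op_bounded that)
      show ?thesis
        unfolding K_def
      proof (rule eigenvalues_off_1_bound)
        show "U n * toeplitz n f = 1\<^sub>m n + U n * D (\<lambda>t. f t - p t) + U n * D p"
          unfolding U_def D_def by (rule preconditioned_decomposition[OF continuous nz pcont])
        have "op_bounded n (1 / \<mu> * (\<delta> + \<delta>)) (U n * D (\<lambda>t. f t - p t))"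
          using close less_imp_le continuous pcont \<mu>
          by (intro op_bounded_mult U D continuous_intros) auto
        then show "op_bounded n (\<epsilon> / 4) (U n * D (\<lambda>t. f t - p t))"
          using \<mu> by (simp add: \<delta>_def)
        show "op_bounded n M (U n * D p)"
          unfolding M_def using \<mu> by (intro op_bounded_mult U D pcont s) auto
        have "card J \<le> card ({..<d} \<union> {n - d..<n})"
          by (rule card_mono) (auto simp: J_def)
        also have "\<dots> \<le> card {..<d} + card {n - d..<n}" by (rule card_Un_le)
        also have "\<dots> \<le> 2 * d" by simp
        finally show "card J \<le> 2 * d" .
        show "(U n * D p) $$ (i, k) = 0" if "i < n" "k < n" "k \<notin> J" for i k
        proof -
          have "D p $$ (l, k) = 0" if "l < n" for l
            using d[of l n k] \<open>l < n\<close> \<open>k < n\<close> \<open>k \<notin> J\<close> Tc[of n p] circulant_carrier[of n p]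
            by (auto simp: D_def J_def)
          moreover have "D p \<in> carrier_mat n n" "U n \<in> carrier_mat n n"
            by (rule op_boundedD(1)[OF D[OF pcont s]] op_boundedD(1)[OF U])+
          ultimately show ?thesis using that by (auto simp: scalar_prod_def)
        qed
      qed (use \<epsilon> \<mu> s0 in \<open>auto simp: M_def J_def\<close>)
    qed
    then have "(\<Sum>z\<in>{z \<in> spectrum (U n * toeplitz n f). cmod (z - 1) \<ge> \<epsilon>}.
      order z (char_poly (U n * toeplitz n f))) \<le> nat \<lceil>K\<rceil>" for n
      by (meson le_nat_iff of_nat_le_iff order_trans real_nat_ceiling_ge)
    then show ?thesis by blast
  qed
  have "U n * toeplitz n f \<in> carrier_mat n n" for n
    by (rule mult_carrier_mat[OF op_boundedD(1)[OF U] Tc])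
  with bound show ?thesis unfolding properly_clustered_def inv by blast
qed

end
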